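(* Let $n$ and $k$ satisfy $2 \le k \le \frac{1}{648}\log\log\log n$. Let $G$ be an $n$-vertex graph satisfying: (i) $G$ has average degree at least $k$ and maximum degree at most $6k$; (ii) $G$ has girth at least $\log n/(6k)^2$; (iii) every $t$-vertex subgraph $H$ of $G$ with $t\ge \log n/(6k)^2$ satisfies $\mathrm{sep}_V(H) \le \mathrm{sep}_E(H)\le \frac{t}{\log t}(\log\log t)^2$. Let $H$ be a $t$-vertex subgraph of $G$. Then for every $1/t \le \mu \le 2/3$ there is a subset of $V(H)$ of size in $[\mu t/3,\mu t]$ whose vertex expansion in $H$ is at most $$\frac{\log (1/\mu)}{\log t}\cdot(14\log\log t)^2 .$$
   Context: Graphs are finite, simple and undirected; subgraphs are not necessarily induced; $\log$ denotes $\log_2$. The girth of a graph is the minimum length of a cycle in it. An edge separator in a graph $G=(V,E)$ is a set $F\subseteq E$ for which there is a partition $V=A\cup B$ with $|A|,|B|\le\frac23|V|$ and no edge of $E\setminus F$ between $A$ and $B$; $\mathrm{sep}_E(G)$ is the minimum cardinality of an edge separator. A vertex separator is a set $S\subseteq V$ such that $V\setminus S$ can be partitioned into two sets $A,B$ with $|A|,|B|\le\frac23|V|$ and no edge of $G$ between $A$ and $B$; $\mathrm{sep}_V(G)$ is the minimum cardinality of a vertex separator. A nonempty subset $S\subseteq V(H)$ has vertex expansion $\alpha$ in $H$ if $|N(S)|=\alpha|S|$, where $N(S)$ is the set of vertices of $H$ outside $S$ that have a neighbor (in $H$) in $S$.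
   Formalization: The subgraph H is required to have t ≥ 3 vertices: for t = 2 the claimed bound is 0 (log log 2 = 0), while a single edge with μ = 1/2 has only one-vertex sets of vertex expansion 1; for t = 1 the range of μ is empty. *)

theory Defs
  imports Complex_Main "HOL-Library.Extended_Real"
begin

definition simple_graph :: "'a set \<Rightarrow> 'a set set \<Rightarrow> bool" where
  "simple_graph V E \<longleftrightarrow> finite V \<and> (\<forall>e\<in>E. e \<subseteq> V \<and> card e = 2)"

text \<open>Subgraphs are not necessarily induced.\<close>

definition subgraph :: "'a set \<Rightarrow> 'a set set \<Rightarrow> 'a set \<Rightarrow> 'a set set \<Rightarrow> bool" where
  "subgraph V' E' V E \<longleftrightarrow> simple_graph V' E' \<and> V' \<subseteq> V \<and> E' \<subseteq> E"

definition degree :: "'a set set \<Rightarrow> 'a \<Rightarrow> nat" where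
  "degree E v = card {e \<in> E. v \<in> e}"

definition average_degree :: "'a set \<Rightarrow> 'a set set \<Rightarrow> real" where
  "average_degree V E = (\<Sum>v\<in>V. real (degree E v)) / real (card V)"

definition max_degree :: "'a set \<Rightarrow> 'a set set \<Rightarrow> nat" where
  "max_degree V E = Max (degree E ` V)"

text \<open>A cycle is given by the list of its vertices in cyclic order, without repeating the
  first vertex at the end; so the length of the list is the length of the cycle.\<close>

definition is_cycle :: "'a set set \<Rightarrow> 'a list \<Rightarrow> bool" where
  "is_cycle E c \<longleftrightarrow> 3 \<le> length c \<and> distinct c \<and>
     (\<forall>i<length c. {c ! i, c ! (Suc i mod length c)} \<in> E)"

text \<open>The girth of a forest is \<open>\<infinity>\<close>.\<close>

definition girth :: "'a set set \<Rightarrow> enat" where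
  "girth E = (INF c\<in>{c. is_cycle E c}. enat (length c))"

text \<open>In the two separator notions the parts \<open>A\<close> and \<open>B\<close> may be empty, as long as both satisfy the
  size bound.\<close>

definition edge_separator :: "'a set \<Rightarrow> 'a set set \<Rightarrow> 'a set set \<Rightarrow> bool" where
  "edge_separator V E F \<longleftrightarrow> F \<subseteq> E \<and>
     (\<exists>A B. A \<union> B = V \<and> A \<inter> B = {} \<and>
        real (card A) \<le> 2/3 * real (card V) \<and> real (card B) \<le> 2/3 * real (card V) \<and>
        (\<forall>a\<in>A. \<forall>b\<in>B. {a, b} \<notin> E - F))"

definition vertex_separator :: "'a set \<Rightarrow> 'a set set \<Rightarrow> 'a set \<Rightarrow> bool" where
  "vertex_separator V E S \<longleftrightarrow> S \<subseteq> V \<and>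
     (\<exists>A B. A \<union> B = V - S \<and> A \<inter> B = {} \<and>
        real (card A) \<le> 2/3 * real (card V) \<and> real (card B) \<le> 2/3 * real (card V) \<and>
        (\<forall>a\<in>A. \<forall>b\<in>B. {a, b} \<notin> E))"

text \<open>A vertex separator always exists (take \<open>S = V\<close>).  An edge separator exists unless the
  graph has exactly one vertex, in which case \<open>sep_E\<close> is unspecified.\<close>

definition sep_E :: "'a set \<Rightarrow> 'a set set \<Rightarrow> nat" where
  "sep_E V E = (LEAST m. \<exists>F. edge_separator V E F \<and> card F = m)"

definition sep_V :: "'a set \<Rightarrow> 'a set set \<Rightarrow> nat" where
  "sep_V V E = (LEAST m. \<exists>S. vertex_separator V E S \<and> card S = m)"

definition neighborhood :: "'a set \<Rightarrow> 'a set set \<Rightarrow> 'a set \<Rightarrow> 'a set" where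
  "neighborhood V E S = {v \<in> V - S. \<exists>u\<in>S. {u, v} \<in> E}"

text \<open>Meaningful for nonempty \<open>S\<close> only.\<close>

definition vertex_expansion :: "'a set \<Rightarrow> 'a set set \<Rightarrow> 'a set \<Rightarrow> real" where
  "vertex_expansion V E S = real (card (neighborhood V E S)) / real (card S)"

end

theory Submission
  imports Defs
begin

text \<open>Write \<open>T = log n / (6 k)\<^sup>2\<close>. If \<open>t < T\<close>, the girth bound makes \<open>H\<close> a forest, and a forest has
  sets of any prescribed size (up to a factor 2) with at most one neighbor. If \<open>t \<ge> T\<close>, the maximum
  degree is at most \<open>log log t\<close>, so any set of the right size will do when \<open>\<mu> < 1 / sqrt t\<close>, and
  otherwise one applies edge separators recursively, starting from \<open>V(H)\<close>. All sets met on the way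
  have at least \<open>sqrt t\<close> vertices, so each step adds at most \<open>4 (log log t)\<^sup>2 / log t\<close> to the ratio of
  edge boundary to size. Sets with fewer than \<open>T\<close> vertices, where the separator hypothesis does not
  apply, again induce forests and are cut by the edges at a single vertex.\<close>

section \<open>Edge boundaries and balanced cuts\<close>

definition edge_boundary :: "'a set set \<Rightarrow> 'a set \<Rightarrow> 'a set set" where
  "edge_boundary E A = {e \<in> E. e \<inter> A \<noteq> {} \<and> \<not> e \<subseteq> A}"

definition edges_between :: "'a set set \<Rightarrow> 'a set \<Rightarrow> 'a set \<Rightarrow> 'a set set" where
  "edges_between E A B = {e \<in> E. e \<inter> A \<noteq> {} \<and> e \<inter> B \<noteq> {}}"

definition induced_edges :: "'a set set \<Rightarrow> 'a set \<Rightarrow> 'a set set" where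
  "induced_edges E A = {e \<in> E. e \<subseteq> A}"

lemma simple_graph_finite_edges: "simple_graph V E \<Longrightarrow> finite E"
  unfolding simple_graph_def by (meson Pow_iff finite_Pow_iff finite_subset subsetI)

lemma edge_meets_disjoint:
  assumes "card e = 2" "e \<inter> A \<noteq> {}" "e \<inter> B \<noteq> {}" "A \<inter> B = {}"
  obtains a b where "a \<in> A" "b \<in> B" "e = {a, b}"
proof -
  obtain a b where ab: "a \<in> e" "a \<in> A" "b \<in> e" "b \<in> B" using assms(2,3) by blast
  have "a \<noteq> b" using ab assms(4) by blast
  moreover obtain x y where "e = {x, y}" using assms(1) by (meson card_2_iff)
  ultimately have "e = {a, b}" using ab by auto
  then show thesis using that ab by blast
qed

lemma edges_between_subset_induced:
  assumes "simple_graph V E" "A \<inter> B = {}"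
  shows "edges_between E A B \<subseteq> induced_edges E (A \<union> B)"
proof
  fix e assume e: "e \<in> edges_between E A B"
  then have "card e = 2" using assms(1) by (auto simp: edges_between_def simple_graph_def)
  then obtain a b where "a \<in> A" "b \<in> B" "e = {a, b}"
    using e assms(2) edge_meets_disjoint[of e A B] by (auto simp: edges_between_def)
  then show "e \<in> induced_edges E (A \<union> B)"
    using e by (auto simp: edges_between_def induced_edges_def)
qed

lemma induced_subgraph:
  assumes "subgraph VH EH V E" "C \<subseteq> VH"
  shows "subgraph C (induced_edges EH C) V E"
  using assms finite_subset[of C VH]
  unfolding subgraph_def simple_graph_def induced_edges_def by auto

text \<open>An edge leaving \<open>A\<close> either leaves \<open>A \<union> B\<close> or runs to
  \<open>B\<close>. A boundary edge of \<open>A \<union> B\<close> meets at most one of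
  \<open>A\<close> and \<open>B\<close>, so it is counted at most once on the left; an edge between
  \<open>A\<close> and \<open>B\<close> is counted twice.\<close>

lemma card_edge_boundary_Un_le:
  assumes G: "simple_graph V E" and AB: "A \<inter> B = {}"
  shows "card (edge_boundary E A) + card (edge_boundary E B)
    \<le> card (edge_boundary E (A \<union> B)) + 2 * card (edges_between E A B)"
proof -
  have fin: "finite E" using G by (rule simple_graph_finite_edges)
  define X where "X A' = {e \<in> edge_boundary E (A \<union> B). e \<inter> A' \<noteq> {}}" for A'
  have finX: "finite (X A')" "finite (edge_boundary E A')" "finite (edges_between E A B)" for A'
    using fin by (auto simp: X_def edge_boundary_def edges_between_def)
  have sub: "edge_boundary E A \<subseteq> X A \<union> edges_between E A B"
    "edge_boundary E B \<subseteq> X B \<union> edges_between E A B"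
    by (auto simp: X_def edge_boundary_def edges_between_def)
  have "X A \<inter> X B = {}"
  proof -
    have "X A \<inter> X B \<subseteq> edges_between E A B"
      by (auto simp: X_def edge_boundary_def edges_between_def)
    moreover have "edges_between E A B \<inter> X A = {}"
      using edges_between_subset_induced[OF G AB]
      by (auto simp: X_def edge_boundary_def induced_edges_def)
    ultimately show ?thesis by blast
  qed
  then have "card (X A) + card (X B) = card (X A \<union> X B)"
    using finX by (simp add: card_Un_disjoint)
  also have "\<dots> \<le> card (edge_boundary E (A \<union> B))"
    using finX by (intro card_mono) (auto simp: X_def)
  finally have 1: "card (X A) + card (X B) \<le> card (edge_boundary E (A \<union> B))" .
  have 2: "card (edge_boundary E A) \<le> card (X A) + card (edges_between E A B)"
    "card (edge_boundary E B) \<le> card (X B) + card (edges_between E A B)"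
    using sub finX by (meson card_Un_le card_mono finite_UnI le_trans)+
  show ?thesis using 1 2 by linarith
qed

text \<open>Each outside neighbor \<open>v\<close> picks an edge \<open>{g v, v}\<close> back into
  \<open>S\<close>. The choice is injective, since \<open>v\<close> is the only end of this edge
  outside \<open>S\<close>.\<close>

lemma card_neighborhood_le_edge_boundary:
  assumes "finite E"
  shows "card (neighborhood V E S) \<le> card (edge_boundary E S)"
proof -
  define g where "g v = (SOME u. u \<in> S \<and> {u, v} \<in> E)" for v
  have g: "g v \<in> S" "{g v, v} \<in> E" "v \<notin> S" if "v \<in> neighborhood V E S" for v
    using that someI_ex[of "\<lambda>u. u \<in> S \<and> {u, v} \<in> E"] by (auto simp: neighborhood_def g_def)
  have "inj_on (\<lambda>v. {g v, v}) (neighborhood V E S)"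
    using g by (auto simp: inj_on_def doubleton_eq_iff)
  moreover have "(\<lambda>v. {g v, v}) ` neighborhood V E S \<subseteq> edge_boundary E S"
    using g by (auto simp: edge_boundary_def)
  moreover have "finite (edge_boundary E S)" using assms by (simp add: edge_boundary_def)
  ultimately show ?thesis by (rule card_inj_on_le)
qed

lemma card_edge_boundary_le_degree:
  assumes "finite S" "finite E" "\<And>v. v \<in> S \<Longrightarrow> real (degree E v) \<le> d"
  shows "real (card (edge_boundary E S)) \<le> d * real (card S)"
proof -
  have "card (edge_boundary E S) \<le> card (\<Union>v\<in>S. {e \<in> E. v \<in> e})"
    using assms by (intro card_mono) (auto simp: edge_boundary_def)
  also have "\<dots> \<le> (\<Sum>v\<in>S. degree E v)"
    using card_UN_le[OF assms(1)] by (simp add: degree_def)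
  finally have "real (card (edge_boundary E S)) \<le> (\<Sum>v\<in>S. real (degree E v))"
    by (metis of_nat_le_iff of_nat_sum)
  also have "\<dots> \<le> d * real (card S)" using sum_bounded_above[of S "\<lambda>v. real (degree E v)" d] assms(3)
    by (simp add: mult.commute)
  finally show ?thesis .
qed

text \<open>Of the two sides of a balanced cut keep the one with the smaller ratio of edge boundary to
  size. This ratio grows by at most \<open>2 * \<phi>\<close> in each step, and the size shrinks by a factor between
  \<open>1/3\<close> and \<open>2/3\<close>.\<close>

lemma small_edge_boundary_of_balanced_cuts:
  fixes \<phi> x :: real
  assumes G: "simple_graph V E" and x: "x > 0" and \<phi>: "\<phi> \<ge> 0"
    and cut: "\<And>C. C \<subseteq> V \<Longrightarrow> x < card C \<Longrightarrow>
      \<exists>A B. A \<union> B = C \<and> A \<inter> B = {} \<and> card A \<le> 2/3 * real (card C) \<and>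
        card B \<le> 2/3 * real (card C) \<and> card (edges_between E A B) \<le> \<phi> * card C"
    and C: "C \<subseteq> V" "x < card C"
  shows "\<exists>S \<subseteq> C. x / 3 \<le> card S \<and> card S \<le> x \<and>
    card (edge_boundary E S) / card S
      \<le> card (edge_boundary E C) / card C + 2 * \<phi> * (log (3/2) (card C / x) + 1)"
  using C
proof (induction "card C" arbitrary: C rule: less_induct)
  case less
  obtain A B where AB: "A \<union> B = C" "A \<inter> B = {}" "card A \<le> 2/3 * real (card C)"
    "card B \<le> 2/3 * real (card C)" "card (edges_between E A B) \<le> \<phi> * card C"
    using cut[OF less.prems] by blast
  have finC: "finite C" using less.prems(1) G finite_subset by (auto simp: simple_graph_def)
  have cC: "real (card C) > 0" using less.prems(2) x by linarith
  have "card C = card A + card B" using AB finC by (metis card_Un_disjoint finite_Un)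
  then have cAB: "real (card C) = real (card A) + real (card B)" by simp
  let ?b = "\<lambda>A. real (card (edge_boundary E A))"
  let ?r = "?b C / card C + 2 * \<phi>"
  \<comment> \<open>Averaging: if both sides exceeded the ratio \<open>?r\<close>, adding up would
    contradict the bound on the boundary of a union. Each side has at least a third of
    \<open>C\<close> because the other has at most two thirds.\<close>
  have "\<exists>D. D \<subseteq> C \<and> card D \<le> 2/3 * real (card C) \<and> card D \<ge> 1/3 * real (card C)
    \<and> ?b D \<le> ?r * card D"
  proof (rule ccontr)
    assume no: "\<not> ?thesis"
    have "?b A > ?r * card A" "?b B > ?r * card B"
      using no AB cAB by (force simp: not_le)+
    moreover have "?r * card C = ?r * card A + ?r * card B" by (simp only: cAB distrib_left)
    ultimately have "?b A + ?b B > ?r * card C" by linarith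
    also have "?r * card C = ?b C + 2 * \<phi> * card C" using cC by (simp add: field_simps)
    finally have "?b A + ?b B > ?b C + 2 * \<phi> * card C" .
    moreover have "?b A + ?b B \<le> ?b C + 2 * real (card (edges_between E A B))"
      using card_edge_boundary_Un_le[OF G AB(2), unfolded AB(1)] by linarith
    ultimately show False using AB(5) by linarith
  qed
  then obtain D where D: "D \<subseteq> C" "card D \<le> 2/3 * real (card C)" "card D \<ge> 1/3 * real (card C)"
    "?b D \<le> ?r * card D" by blast
  have cD: "real (card D) > 0" using D(3) cC by linarith
  have rD: "?b D / card D \<le> ?r" using D(4) cD by (simp add: field_simps)
  show ?case
  proof (cases "card D \<le> x")
    case True
    \<comment> \<open>For the last cut, the summand 1 next to the logarithm pays.\<close>
    have "log (3/2) (card C / x) \<ge> 0" using less.prems(2) x by (simp add: field_simps)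
    then have "2 * \<phi> * (log (3/2) (card C / x) + 1) \<ge> 2 * \<phi> * 1"
      using \<phi> by (intro mult_left_mono) auto
    then have "?b D / card D \<le> ?b C / card C + 2 * \<phi> * (log (3/2) (card C / x) + 1)"
      using rD by linarith
    moreover have "x / 3 \<le> card D" using D(3) less.prems(2) by linarith
    ultimately show ?thesis using D(1) True by blast
  next
    case False
    have "card D < card C" using D(2) cC by linarith
    then obtain S where S: "S \<subseteq> D" "x / 3 \<le> card S" "card S \<le> x"
      "?b S / card S \<le> ?b D / card D + 2 * \<phi> * (log (3/2) (card D / x) + 1)"
      using less.hyps[of D] D(1) less.prems(1) False by force
    \<comment> \<open>The size drops to at most \<open>2/3\<close>, so the logarithm to base
      \<open>3/2\<close> drops by at least 1. This pays for the growth \<open>2 * \<phi>\<close> of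
      the ratio.\<close>
    have "log (3/2) (card D / x) \<le> log (3/2) ((card C / x) / (3/2))"
      using D(2) cD x cC by (subst log_le_cancel_iff) (auto simp: field_simps)
    also have "\<dots> = log (3/2) (card C / x) - 1"
      using cC x by (subst log_divide) auto
    finally have "2 * \<phi> * (log (3/2) (card D / x) + 1) \<le> 2 * \<phi> * log (3/2) (card C / x)"
      using \<phi> by (intro mult_left_mono) auto
    then have "?b S / card S \<le> ?b C / card C + 2 * \<phi> * (log (3/2) (card C / x) + 1)"
      using S(4) rD by (simp add: algebra_simps)
    then show ?thesis using S D(1) by blast
  qed
qed

section \<open>Paths, cycles and sets with one outside neighbor in forests\<close>

text \<open>Induction on reachability: the new vertex is appended, or, if it already lies on the
  path, the path is cut off there.\<close>

lemma rtranclp_imp_distinct_path: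
  assumes "(\<lambda>a b. a \<in> C \<and> b \<in> C \<and> {a, b} \<in> E)\<^sup>*\<^sup>* v w" "v \<in> C"
  shows "\<exists>p. p \<noteq> [] \<and> hd p = v \<and> last p = w \<and> distinct p \<and> set p \<subseteq> C \<and>
    successively (\<lambda>a b. {a, b} \<in> E) p"
  using assms(1)
proof induction
  case base
  then show ?case using assms(2) by (intro exI[of _ "[v]"]) auto
next
  case (step y z)
  then obtain p where p: "p \<noteq> []" "hd p = v" "last p = y" "distinct p" "set p \<subseteq> C"
    "successively (\<lambda>a b. {a, b} \<in> E) p" by blast
  show ?case
  proof (cases "z \<in> set p")
    case True
    then obtain q r where "p = q @ z # r" by (meson split_list)
    then show ?thesis using p
      by (intro exI[of _ "q @ [z]"]) (auto simp: successively_append_iff hd_append)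
  next
    case False
    then show ?thesis using p step.hyps
      by (intro exI[of _ "p @ [z]"]) (auto simp: successively_append_iff)
  qed
qed

lemma is_cycle_of_path:
  assumes p: "distinct p" "2 \<le> length p" "successively (\<lambda>a b. {a, b} \<in> E) p"
    and u: "u \<notin> set p" "{u, hd p} \<in> E" "{u, last p} \<in> E"
  shows "is_cycle E (u # p)"
proof -
  have p0: "p \<noteq> []" using p(2) by auto
  have "{(u # p) ! i, (u # p) ! (Suc i mod length (u # p))} \<in> E" if i: "i < length (u # p)" for i
  proof (cases i)
    case 0
    then show ?thesis using p0 u(2) by (simp add: hd_conv_nth)
  next
    case (Suc j)
    show ?thesis
    proof (cases "Suc j < length p")
      case True
      then have "{p ! j, p ! Suc j} \<in> E" using p(3) by (simp add: successively_conv_nth)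
      then show ?thesis using True Suc by simp
    next
      case False
      \<comment> \<open>The last index wraps around to \<open>u\<close>.\<close>
      then have "j = length p - 1" "Suc j = length p" using i Suc by auto
      then show ?thesis using Suc u(3) p0 by (simp add: last_conv_nth insert_commute)
    qed
  qed
  then show ?thesis using p u(1) by (auto simp: is_cycle_def)
qed

text \<open>A set \<open>C\<close> of minimal size among those with more than \<open>x\<close> vertices and at most one outside
  neighbor \<open>u\<close> works after removing one vertex (the unique neighbor of \<open>u\<close>); if \<open>u\<close> has two neighbors
  in \<open>C\<close>, then these are in different components of \<open>C\<close>, and \<open>C\<close> splits.\<close>

lemma forest_one_neighbor_set:
  fixes x :: real
  assumes G: "simple_graph V E" and forest: "\<And>c. \<not> is_cycle E c"
    and x: "1 \<le> x" "x < card V"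
  shows "\<exists>S u. S \<subseteq> V \<and> x / 2 \<le> card S \<and> card S \<le> x \<and> neighborhood V E S \<subseteq> {u}"
proof -
  define P where "P C \<longleftrightarrow> C \<subseteq> V \<and> x < card C \<and> (\<exists>u. neighborhood V E C \<subseteq> {u})" for C
  have "P V" using x by (auto simp: P_def neighborhood_def)
  then obtain C where C: "P C" and min: "\<And>D. P D \<Longrightarrow> card C \<le> card D"
    using ex_has_least_nat[of P V card] by blast
  have finV: "finite V" using G by (simp add: simple_graph_def)
  have CV: "C \<subseteq> V" and cC: "x < card C" using C by (auto simp: P_def)
  have finC: "finite C" using CV finV finite_subset by blast
  have smaller: "card D \<le> x" if "D \<subset> C" "neighborhood V E D \<subseteq> {u}" for D u
    using min[of D] that psubset_card_mono[OF finC that(1)] CV by (force simp: P_def)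
  obtain u where u: "neighborhood V E C \<subseteq> {u}" using C by (auto simp: P_def)
  have remove: ?thesis if v: "v \<in> C" "neighborhood V E (C - {v}) \<subseteq> {v}" for v
  proof -
    have "card (C - {v}) \<le> x" using smaller[of "C - {v}" v] v by blast
    moreover have "real (card (C - {v})) = card C - 1"
      using v(1) finC cC x by (simp add: card_Diff_singleton)
    \<comment> \<open>For \<open>x \<ge> 2\<close> this is \<open>x - 1 \<ge> x / 2\<close>; for
      \<open>x < 2\<close> it needs integrality, which gives \<open>card C \<ge> 2\<close>.\<close>
    moreover have "x / 2 \<le> real (card C) - 1"
    proof (cases "x \<ge> 2")
      case False
      have "card C \<ge> 2" using cC x by linarith
      then show ?thesis using False by linarith
    qed (use cC in linarith)
    ultimately show ?thesis using CV v(2) by (intro exI[of _ "C - {v}"] exI[of _ v]) auto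
  qed
  have nbr: "y = u" if "a \<in> C" "{a, y} \<in> E" "y \<notin> C" for a y
  proof -
    have "y \<in> V" using that(2) G by (auto simp: simple_graph_def)
    then show ?thesis using u that by (auto simp: neighborhood_def)
  qed
  have remove_nbr: ?thesis if v: "v \<in> C" "\<And>a. a \<in> C \<Longrightarrow> {a, u} \<in> E \<Longrightarrow> a = v \<or> u \<in> C" for v
  proof (rule remove[OF v(1)], rule subsetI)
    fix y assume "y \<in> neighborhood V E (C - {v})"
    then obtain a where a: "a \<in> C" "a \<noteq> v" "{a, y} \<in> E" "y \<notin> C - {v}"
      by (auto simp: neighborhood_def)
    then show "y \<in> {v}" using nbr[of a y] v(2)[of a] by blast
  qed
  \<comment> \<open>The first case includes \<open>u \<in> C\<close>: then \<open>C\<close> has no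
    outside neighbor at all, and any vertex can be removed.\<close>
  consider (none) "\<And>a. a \<in> C \<Longrightarrow> {a, u} \<notin> E \<or> u \<in> C"
    | (one) v where "v \<in> C" "u \<notin> C" "{v, u} \<in> E" "\<And>a. a \<in> C \<Longrightarrow> {a, u} \<in> E \<Longrightarrow> a = v"
    | (two) v w where "v \<in> C" "w \<in> C" "v \<noteq> w" "u \<notin> C" "{v, u} \<in> E" "{w, u} \<in> E"
    by metis
  then show ?thesis
  proof cases
    case none
    obtain v where "v \<in> C" using cC x by fastforce
    then show ?thesis using none by (intro remove_nbr) auto
  next
    case one
    then show ?thesis by (intro remove_nbr) auto
  next
    case two
    \<comment> \<open>\<open>D\<close> is the component of \<open>v\<close> in the graph induced on
      \<open>C\<close>. A path from \<open>v\<close> to \<open>w\<close> inside \<open>C\<close>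
      would close to a cycle through \<open>u\<close>, so \<open>w\<close> lies outside
      \<open>D\<close>.\<close>
    define R where "R a b \<longleftrightarrow> a \<in> C \<and> b \<in> C \<and> {a, b} \<in> E" for a b
    define D where "D = {y. R\<^sup>*\<^sup>* v y}"
    have DC: "D \<subseteq> C"
    proof
      fix y assume "y \<in> D"
      then have "R\<^sup>*\<^sup>* v y" by (simp add: D_def)
      then show "y \<in> C" using two(1) by induction (auto simp: R_def)
    qed
    have "w \<notin> D"
    proof
      assume "w \<in> D"
      then obtain p where p: "p \<noteq> []" "hd p = v" "last p = w" "distinct p" "set p \<subseteq> C"
        "successively (\<lambda>a b. {a, b} \<in> E) p"
        using rtranclp_imp_distinct_path[of C E v w] two(1) by (auto simp: D_def R_def[abs_def])
      have "2 \<le> length p" using p(1-3) two(3) by (cases p; cases "tl p") auto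
      then have "is_cycle E (u # p)"
        using p two by (intro is_cycle_of_path) (auto simp: insert_commute)
      then show False using forest by blast
    qed
    have closed: "b \<in> D" if "a \<in> D" "b \<in> C" "{a, b} \<in> E" for a b
    proof -
      have "R a b" using that DC by (auto simp: R_def)
      then show ?thesis using that(1) by (auto simp: D_def)
    qed
    have "v \<in> D" by (simp add: D_def)
    have N: "neighborhood V E D \<subseteq> {u}" "neighborhood V E (C - D) \<subseteq> {u}"
    proof -
      show "neighborhood V E D \<subseteq> {u}"
        using DC closed nbr unfolding neighborhood_def by blast
      show "neighborhood V E (C - D) \<subseteq> {u}"
      proof
        fix y assume "y \<in> neighborhood V E (C - D)"
        then obtain a where "a \<in> C - D" "{a, y} \<in> E" "y \<notin> C - D"
          by (auto simp: neighborhood_def)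
        then show "y \<in> {u}" using closed[of y a] nbr[of a y] DC by (auto simp: insert_commute)
      qed
    qed
    \<comment> \<open>Both pieces are proper subsets of \<open>C\<close>, so minimality bounds them
      by \<open>x\<close>; the larger one has at least half of \<open>C\<close>.\<close>
    have "card D \<le> x" "card (C - D) \<le> x"
      using smaller[OF _ N(1)] smaller[OF _ N(2)] DC \<open>v \<in> D\<close> \<open>w \<notin> D\<close> two(1,2) by auto
    moreover have "card C = card D + card (C - D)"
      using DC finC by (metis card_Diff_subset card_mono finite_subset le_add_diff_inverse)
    then have "x / 2 \<le> card D \<or> x / 2 \<le> card (C - D)" using cC by linarith
    ultimately show ?thesis using N DC CV by (metis Diff_subset subset_trans)
  qed
qed

section \<open>Balanced cuts from edge separators and from forests\<close>

text \<open>The minimum exists because deleting all edges separates any halving of \<open>V\<close>.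
  A single vertex has to be excluded, since it exceeds \<open>2/3\<close>.\<close>

lemma sep_E_attained:
  assumes "simple_graph V E" "2 \<le> card V"
  obtains F where "edge_separator V E F" "card F = sep_E V E"
proof -
  have fin: "finite V" using assms by (simp add: simple_graph_def)
  obtain A where A: "A \<subseteq> V" "card A = card V div 2"
    using obtain_subset_with_card_n[of "card V div 2" V] by auto
  have "card (V - A) = card V - card V div 2"
    using A fin by (simp add: card_Diff_subset finite_subset)
  moreover have "3 * (card V div 2) \<le> 2 * card V" "3 * (card V - card V div 2) \<le> 2 * card V"
    using assms(2) by linarith+
  ultimately have "real (3 * card A) \<le> real (2 * card V)" "real (3 * card (V - A)) \<le> real (2 * card V)"
    using A(2) by (simp_all only: of_nat_le_iff)
  then have "edge_separator V E E"
    unfolding edge_separator_def using A(1) by (intro conjI exI[of _ A] exI[of _ "V - A"]) auto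
  then have "\<exists>m F. edge_separator V E F \<and> card F = m" by blast
  then have "\<exists>F. edge_separator V E F \<and> card F = sep_E V E"
    unfolding sep_E_def by (rule LeastI_ex)
  then show thesis using that by blast
qed

text \<open>An edge between the two sides of an optimal separator lies in the graph induced on
  \<open>C\<close>, hence in the separator.\<close>

lemma balanced_cut_of_sep_E:
  assumes G: "simple_graph V E" and C: "C \<subseteq> V" "2 \<le> card C"
  shows "\<exists>A B. A \<union> B = C \<and> A \<inter> B = {} \<and> card A \<le> 2/3 * real (card C) \<and>
    card B \<le> 2/3 * real (card C) \<and> card (edges_between E A B) \<le> sep_E C (induced_edges E C)"
proof -
  have G': "simple_graph C (induced_edges E C)"
    using induced_subgraph[of V E V E C] G C by (auto simp: subgraph_def)
  obtain F where F: "edge_separator C (induced_edges E C) F" "card F = sep_E C (induced_edges E C)"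
    using sep_E_attained[OF G' C(2)] .
  then obtain A B where AB: "A \<union> B = C" "A \<inter> B = {}" "card A \<le> 2/3 * real (card C)"
    "card B \<le> 2/3 * real (card C)"
    "\<forall>a\<in>A. \<forall>b\<in>B. {a, b} \<notin> induced_edges E C - F" "F \<subseteq> induced_edges E C"
    unfolding edge_separator_def by blast
  have "edges_between E A B \<subseteq> F"
  proof
    fix e assume e: "e \<in> edges_between E A B"
    then have ind: "e \<in> induced_edges E C"
      using edges_between_subset_induced[OF G AB(2)] AB(1) by auto
    have "card e = 2" using e G by (auto simp: edges_between_def simple_graph_def)
    then obtain a b where "a \<in> A" "b \<in> B" "e = {a, b}"
      using e AB(2) edge_meets_disjoint[of e A B] by (auto simp: edges_between_def)
    then show "e \<in> F" using ind AB(5) by blast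
  qed
  moreover have "finite F" using AB(6) simple_graph_finite_edges[OF G'] finite_subset by blast
  ultimately have "card (edges_between E A B) \<le> card F" by (rule card_mono[rotated])
  then show ?thesis using AB F(2) by metis
qed

text \<open>A set with a single outside neighbor \<open>u\<close>, of size between
  \<open>1/3\<close> and \<open>2/3\<close> of \<open>C\<close>, is one side of the cut: every
  crossing edge contains \<open>u\<close>.\<close>

lemma balanced_cut_of_forest:
  fixes d :: real
  assumes G: "simple_graph V E" and C: "C \<subseteq> V" "2 \<le> card C"
    and forest: "\<And>c. \<not> is_cycle (induced_edges E C) c"
    and deg: "\<And>v. v \<in> V \<Longrightarrow> real (degree E v) \<le> d" and d: "0 \<le> d"
  shows "\<exists>A B. A \<union> B = C \<and> A \<inter> B = {} \<and> card A \<le> 2/3 * real (card C) \<and>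
    card B \<le> 2/3 * real (card C) \<and> card (edges_between E A B) \<le> d"
proof -
  have G': "simple_graph C (induced_edges E C)"
    using induced_subgraph[of V E V E C] G C by (auto simp: subgraph_def)
  obtain S u where S: "S \<subseteq> C" "2/3 * real (card C) / 2 \<le> card S" "card S \<le> 2/3 * real (card C)"
    "neighborhood C (induced_edges E C) S \<subseteq> {u}"
    using forest_one_neighbor_set[OF G' forest, of "2/3 * real (card C)"] C(2) by auto
  have fin: "finite C" using C G finite_subset by (auto simp: simple_graph_def)
  have "card (C - S) = card C - card S" "card S \<le> card C"
    using S(1) fin by (auto simp: card_Diff_subset finite_subset card_mono)
  then have "card (C - S) \<le> 2/3 * real (card C)" using S(2) by (simp add: of_nat_diff)
  moreover have "card (edges_between E S (C - S)) \<le> d"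
  proof (cases "edges_between E S (C - S) = {}")
    case False
    have sub: "u \<in> C \<and> u \<in> e" if e: "e \<in> edges_between E S (C - S)" for e
    proof -
      have "card e = 2" using e G by (auto simp: edges_between_def simple_graph_def)
      then obtain a b where ab: "a \<in> S" "b \<in> C - S" "e = {a, b}"
        using e edge_meets_disjoint[of e S "C - S"] by (auto simp: edges_between_def)
      then have "b \<in> neighborhood C (induced_edges E C) S"
        using e S(1) by (auto simp: neighborhood_def edges_between_def induced_edges_def)
      then show ?thesis using S(4) ab by auto
    qed
    have "card (edges_between E S (C - S)) \<le> degree E u"
      unfolding degree_def using sub simple_graph_finite_edges[OF G]
      by (intro card_mono) (auto simp: edges_between_def)
    moreover have "u \<in> V" using False sub C(1) by blast
    ultimately show ?thesis using deg[of u] by linarith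
  qed (use d in simp)
  ultimately show ?thesis using S by (intro exI[of _ S] exI[of _ "C - S"]) auto
qed

text \<open>A cycle in a subgraph is a cycle of the whole graph and has at most as many vertices as
  the subgraph.\<close>

lemma no_short_cycle:
  fixes r :: real
  assumes girth: "ereal r \<le> ereal_of_enat (girth E)"
    and H: "simple_graph C EC" "EC \<subseteq> E" and small: "card C < r"
  shows "\<not> is_cycle EC c"
proof
  assume c: "is_cycle EC c"
  then have "is_cycle E c" using H(2) by (auto simp: is_cycle_def)
  then have "girth E \<le> enat (length c)" unfolding girth_def by (intro INF_lower) simp
  then have "ereal_of_enat (girth E) \<le> ereal_of_enat (enat (length c))"
    by (simp only: ereal_of_enat_le_iff)
  with girth have "ereal r \<le> ereal_of_enat (enat (length c))" by (rule order_trans)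
  then have r: "r \<le> length c" by simp
  have "set c \<subseteq> C"
  proof
    fix y assume "y \<in> set c"
    then obtain i where "i < length c" "y = c ! i" by (auto simp: in_set_conv_nth)
    then have "{y, c ! (Suc i mod length c)} \<in> EC" using c by (auto simp: is_cycle_def)
    then show "y \<in> C" using H(1) by (auto simp: simple_graph_def)
  qed
  moreover have "distinct c" "finite C" using c H(1) by (auto simp: is_cycle_def simple_graph_def)
  ultimately have "length c \<le> card C" by (metis card_mono distinct_card)
  then show False using r small by linarith
qed

section \<open>Estimates for iterated logarithms\<close>

lemma log2_three_halves_ge: "log 2 (3/2) \<ge> (1/2 :: real)"
proof -
  have "log 2 ((3/2)^2) \<ge> log 2 (2::real)" by (subst log_le_cancel_iff) (auto simp: power2_eq_square)
  moreover have "log 2 ((3/2)^2) = 2 * log 2 (3/2 :: real)" by (subst log_nat_power) auto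
  ultimately show ?thesis by simp
qed

text \<open>Apply \<open>ln y \<le> y - 1\<close> to \<open>y = sqrt x\<close>; the 4 comes from
  \<open>ln 2 \<ge> 1/2\<close>.\<close>

lemma log2_le_sqrt:
  fixes x :: real
  assumes "x \<ge> 1"
  shows "log 2 x \<le> 4 * sqrt x"
proof -
  have "ln x = 2 * ln (sqrt x)" using assms by (simp add: ln_sqrt)
  also have "\<dots> \<le> 2 * sqrt x" using ln_le_minus_one[of "sqrt x"] assms by simp
  finally have "ln x \<le> 2 * sqrt x" .
  moreover have "ln 2 \<ge> (1/2 :: real)" using ln_le_minus_one[of "1/2"] by (simp add: ln_div)
  then have "4 * sqrt x * ln 2 \<ge> 4 * sqrt x * (1/2)" using assms by (intro mult_left_mono) auto
  ultimately have "ln x \<le> 4 * sqrt x * ln 2" by linarith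
  then show ?thesis by (simp add: log_def divide_simps)
qed

lemma loglog_ge_half:
  fixes x :: real
  assumes "3 \<le> x"
  shows "log 2 x \<ge> 3/2" "log 2 (log 2 x) \<ge> 1/2"
proof -
  have "log 2 (2 * (3/2)) = 1 + log 2 (3/2 :: real)" by (subst log_mult) auto
  moreover have "log 2 (2 * (3/2)) \<le> log 2 x" using assms by (subst log_le_cancel_iff) auto
  ultimately show 1: "log 2 x \<ge> 3/2" using log2_three_halves_ge by linarith
  have "log 2 (log 2 x) \<ge> log 2 (3/2)" using 1 by (subst log_le_cancel_iff) auto
  then show "log 2 (log 2 x) \<ge> 1/2" using log2_three_halves_ge by linarith
qed

lemma log_inverse_mu_ge:
  fixes \<mu> :: real
  assumes "0 < \<mu>" "\<mu> \<le> 2/3"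
  shows "log 2 (1 / \<mu>) \<ge> 1/2"
proof -
  have "log 2 (3/2) \<le> log 2 (1 / \<mu>)" using assms by (subst log_le_cancel_iff) (auto simp: field_simps)
  then show ?thesis using log2_three_halves_ge by linarith
qed

text \<open>In Isabelle \<open>log 2 0 = 0\<close>, so the three logarithms must be shown to be proper.\<close>

lemma triple_log_of_nat:
  assumes "0 < log 2 (log 2 (log 2 (real n)))"
  shows "log 2 (real n) = 2 powr (2 powr (log 2 (log 2 (log 2 (real n)))))"
proof -
  define a where "a = log 2 (real n)"
  define b where "b = log 2 a"
  have c: "0 < log 2 b" using assms by (simp add: a_def b_def)
  have "n \<ge> 2"
  proof (rule ccontr)
    assume "\<not> n \<ge> 2"
    then have "n = 0 \<or> n = 1" by auto
    then have "a = 0" by (auto simp: a_def log_def)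
    then show False using c by (simp add: b_def log_def)
  qed
  then have a: "a \<ge> 1" by (simp add: a_def)
  then have "b \<ge> 0" by (simp add: b_def)
  moreover have "b \<noteq> 0" using c by (auto simp: log_def)
  ultimately have "2 powr (log 2 b) = b" by simp
  moreover have "2 powr b = a" using a by (simp add: b_def)
  ultimately show ?thesis by (simp add: a_def b_def)
qed

text \<open>With \<open>c\<close> the triple logarithm of \<open>n\<close>, \<open>log n\<close> is
  the square of \<open>2 powr (2 powr (c - 1))\<close>. As \<open>(6 * k)^2\<close> is at most one
  of these two factors, \<open>t\<close> is at least the other, so
  \<open>log log t \<ge> c - 1\<close>. This is where the upper bound on \<open>k\<close>
  enters.\<close>

lemma loglog_ge_of_girth_bound:
  fixes k t :: real
  assumes k: "2 \<le> k" "k \<le> 1/648 * log 2 (log 2 (log 2 (real n)))"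
    and t: "log 2 (real n) / (6 * k)^2 \<le> t"
  shows "6 * k \<le> log 2 (log 2 t)" "1000 \<le> log 2 (log 2 t)" "3 \<le> t"
proof -
  define c where "c = log 2 (log 2 (log 2 (real n)))"
  have c: "1296 \<le> c" "108 * (6 * k) \<le> c" using k by (auto simp: c_def)
  have n: "log 2 (real n) = 2 powr (2 powr c)"
    using triple_log_of_nat[of n] c(1) by (simp add: c_def)
  \<comment> \<open>The exponent \<open>c / 4\<close> leaves \<open>2 powr (c / 2)\<close> after
    squaring, and the same inequality then bounds \<open>c / 2\<close>.\<close>
  have c2: "c \<le> 2 powr (c / 4)"
  proof -
    have "log 2 c \<le> 4 * sqrt c" using log2_le_sqrt c(1) by simp
    also have "\<dots> \<le> c / 4"
    proof -
      have "sqrt c \<ge> 16" using c(1) by (simp add: real_le_rsqrt)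
      then have "16 * sqrt c \<le> sqrt c * sqrt c" by (intro mult_right_mono) (use c in auto)
      moreover have "sqrt c * sqrt c = c" using c(1) by simp
      ultimately show ?thesis by linarith
    qed
    finally show ?thesis using c(1) by (subst (asm) log_le_iff) auto
  qed
  have "(6 * k)^2 \<le> c^2" using c k by (intro power_mono) auto
  also have "\<dots> \<le> (2 powr (c / 4))^2" using c2 c by (intro power_mono) auto
  also have "\<dots> = 2 powr (c / 2)" by (simp add: power2_eq_square powr_add[symmetric])
  also have "\<dots> \<le> 2 powr (2 powr (c - 1))"
  proof -
    have "c / 2 \<le> 2 powr (c / 4)" using c2 c by linarith
    also have "\<dots> \<le> 2 powr (c - 1)" using c by simp
    finally show ?thesis by simp
  qed
  finally have k2: "(6 * k)^2 \<le> 2 powr (2 powr (c - 1))" .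
  have "2 powr (2 powr (c - 1)) * (6 * k)^2 \<le> 2 powr (2 powr (c - 1)) * 2 powr (2 powr (c - 1))"
    using k2 by (intro mult_left_mono) auto
  also have "\<dots> = 2 powr (2 * 2 powr (c - 1))" by (simp add: powr_add[symmetric])
  also have "\<dots> = 2 powr (2 powr c)" by (simp add: powr_diff)
  also have "\<dots> \<le> t * (6 * k)^2" using t k unfolding n by (subst (asm) pos_divide_le_eq) auto
  finally have t1: "2 powr (2 powr (c - 1)) \<le> t" using k by simp
  have "0 < (2::real) powr (2 powr (c - 1))" by simp
  then have "0 < t" using t1 by linarith
  with t1 have t2: "2 powr (c - 1) \<le> log 2 t" by (simp add: le_log_iff)
  have "0 < (2::real) powr (c - 1)" by simp
  then have "0 < log 2 t" using t2 by linarith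
  then have t3: "c - 1 \<le> log 2 (log 2 t)" using t2 by (simp add: le_log_iff)
  show "6 * k \<le> log 2 (log 2 t)" "1000 \<le> log 2 (log 2 t)" using t3 c k by linarith+
  have "2 powr 2 \<le> 2 powr (2 powr (c - 1))"
  proof -
    have "2 powr 1 \<le> 2 powr (c - 1)" using c by (intro powr_mono) auto
    then show ?thesis by (intro powr_mono) auto
  qed
  then show "3 \<le> t" using t1 by simp
qed

section \<open>Sets of small expansion, by the sizes of \<open>t\<close> and
  \<open>\<mu>\<close>\<close>

theorem corollary2p6:
  fixes V VH :: "'a set" and E EH :: "'a set set"
    and n t :: nat and k \<mu> :: real
  assumes k: "2 \<le> k" "k \<le> 1/648 * log 2 (log 2 (log 2 (real n)))"
    and G: "simple_graph V E" "card V = n"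
    and avg_deg: "k \<le> average_degree V E"
    and max_deg: "real (max_degree V E) \<le> 6 * k"
    and girth: "ereal (log 2 (real n) / (6 * k)^2) \<le> ereal_of_enat (girth E)"
    and sep: "\<And>V' E' s. subgraph V' E' V E \<Longrightarrow> card V' = s \<Longrightarrow>
        log 2 (real n) / (6 * k)^2 \<le> real s \<Longrightarrow>
        sep_V V' E' \<le> sep_E V' E' \<and>
        real (sep_E V' E') \<le> real s / log 2 (real s) * (log 2 (log 2 (real s)))^2"
    and H: "subgraph VH EH V E" "card VH = t"
    and t: "3 \<le> t"
    and mu: "1 / real t \<le> \<mu>" "\<mu> \<le> 2/3"
  shows "\<exists>S. S \<subseteq> VH \<and> S \<noteq> {} \<and>
      \<mu> * real t / 3 \<le> real (card S) \<and> real (card S) \<le> \<mu> * real t \<and>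
      vertex_expansion VH EH S
        \<le> log 2 (1 / \<mu>) / log 2 (real t) * (14 * log 2 (log 2 (real t)))^2"
proof -
  define T where "T = log 2 (real n) / (6 * k)^2"
  define l where "l = log 2 (log 2 (real t))"
  have H': "simple_graph VH EH" "VH \<subseteq> V" "EH \<subseteq> E" using H by (auto simp: subgraph_def)
  have finE: "finite E" and finEH: "finite EH"
    using simple_graph_finite_edges G(1) H'(1) by blast+
  have finVH: "finite VH" using H'(1) by (simp add: simple_graph_def)
  have t3: "3 \<le> real t" using t by simp
  have lt: "log 2 (real t) \<ge> 3/2" and l: "l \<ge> 1/2" using loglog_ge_half[OF t3] by (auto simp: l_def)
  have mu0: "0 < \<mu>" using mu(1) t3 by (smt (verit) divide_pos_pos)
  have mut: "1 \<le> \<mu> * t" using mu(1) t3 by (simp add: field_simps)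
  have mut2: "\<mu> * t < t" using mu(2) t3 by simp
  have lmu: "log 2 (1 / \<mu>) \<ge> 1/2" using log_inverse_mu_ge mu0 mu(2) by blast
  have ratio0: "0 \<le> log 2 (1 / \<mu>) / log 2 (real t)" using lmu lt by (intro divide_nonneg_nonneg) auto
  \<comment> \<open>For \<open>t < T\<close> only \<open>l \<ge> 1/2\<close> is available, and 49
    suffices there.\<close>
  have l2: "(14 * l)^2 \<ge> 49"
  proof -
    have "7^2 \<le> (14 * l)^2" using l by (intro power_mono) auto
    then show ?thesis by simp
  qed
  \<comment> \<open>For such small \<open>\<mu>\<close> the target is at least half of
    \<open>(14 * l)^2\<close>.\<close>
  have half: "1/2 \<le> log 2 (1 / \<mu>) / log 2 (real t)" if "\<mu> < 1 / sqrt t"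
  proof -
    have "sqrt t \<le> 1 / \<mu>" using that mu0 t3 by (simp add: field_simps)
    then have "log 2 (sqrt t) \<le> log 2 (1 / \<mu>)" using t3 mu0 by (subst log_le_cancel_iff) auto
    moreover have "log 2 (sqrt t) = log 2 t / 2" using t3 by (simp add: log_def ln_sqrt)
    ultimately show ?thesis using lt by (simp add: field_simps)
  qed
  have lsq: "log 2 (real t) \<le> 4 * sqrt t" using log2_le_sqrt t3 by simp
  have sqt: "sqrt t \<le> \<mu> * t" if "\<not> \<mu> < 1 / sqrt t"
  proof -
    have "1 / sqrt t * t \<le> \<mu> * t" using that t3 by (intro mult_right_mono) auto
    then show ?thesis using t3 by (simp add: real_div_sqrt)
  qed
  have deg: "real (degree EH v) \<le> 6 * k" if "v \<in> VH" for v
  proof -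
    have "degree EH v \<le> degree E v"
      unfolding degree_def using H'(3) finE by (intro card_mono) auto
    also have "degree E v \<le> max_degree V E"
      unfolding max_degree_def using G(1) that H'(2) by (intro Max_ge) (auto simp: simple_graph_def)
    finally show ?thesis using max_deg by linarith
  qed
  have small_forest: "\<not> is_cycle (induced_edges EH C) c" if "C \<subseteq> VH" "card C < T" for C c
    using no_short_cycle[OF girth[folded T_def] _ _ that(2), of "induced_edges EH C" c]
      induced_subgraph[OF H(1) that(1)]
    by (auto simp: subgraph_def)
  have goal: ?thesis if "S \<subseteq> VH" "\<mu> * t / 3 \<le> card S" "card S \<le> \<mu> * t"
    "vertex_expansion VH EH S \<le> log 2 (1 / \<mu>) / log 2 (real t) * (14 * l)^2" for S
  proof -
    have "S \<noteq> {}" using that(2) mut by auto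
    then show ?thesis using that unfolding l_def by blast
  qed
  show ?thesis
  proof (cases "t < T")
    case True
    have ind: "induced_edges EH VH = EH" using H'(1) by (auto simp: induced_edges_def simple_graph_def)
    have "\<not> is_cycle EH c" for c using small_forest[of VH c] True H(2) ind by simp
    then obtain S u where S: "S \<subseteq> VH" "\<mu> * t / 2 \<le> card S" "card S \<le> \<mu> * t"
      "neighborhood VH EH S \<subseteq> {u}"
      using forest_one_neighbor_set[OF H'(1) _ mut] mut2 H(2) by metis
    have "0 < real (card S)" using S(2) mut by linarith
    then have cS: "1 \<le> real (card S)" by simp
    have "card (neighborhood VH EH S) \<le> 1" using S(4) card_mono[of "{u}"] by fastforce
    then have exp: "vertex_expansion VH EH S \<le> 1 / card S"
      unfolding vertex_expansion_def using cS by (intro divide_right_mono) auto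
    have "1 / card S \<le> log 2 (1 / \<mu>) / log 2 (real t) * (14 * l)^2"
    proof (cases "\<mu> < 1 / sqrt t")
      case True
      have "1 / card S \<le> 1/2 * (49::real)" using cS by (simp add: field_simps)
      also have "\<dots> \<le> log 2 (1 / \<mu>) / log 2 (real t) * (14 * l)^2"
        using half[OF True] l2 ratio0 by (intro mult_mono) auto
      finally show ?thesis .
    next
      case False
      have "sqrt t / 2 \<le> card S" using sqt[OF False] S(2) by linarith
      \<comment> \<open>The left side is at most \<open>2 / sqrt t\<close>, while the target is at
        least \<open>49 / (8 * sqrt t)\<close> because
        \<open>log t \<le> 4 * sqrt t\<close>.\<close>
      then have "1 / card S \<le> 1 / (sqrt t / 2)" using t3 cS by (intro divide_left_mono) auto
      also have "\<dots> \<le> (1/2) / (4 * sqrt t) * 49" using t3 by (simp add: field_simps)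
      also have "\<dots> \<le> log 2 (1 / \<mu>) / log 2 (real t) * (14 * l)^2"
        using lmu l2 lsq lt t3 ratio0 by (intro mult_mono frac_le) auto
      finally show ?thesis .
    qed
    then show ?thesis using exp S mut by (intro goal[of S]) auto
  next
    case False
    then have T: "log 2 (real n) / (6 * k)^2 \<le> real t" by (simp add: T_def)
    have kl: "6 * k \<le> l" and l1000: "1000 \<le> l"
      using loglog_ge_of_girth_bound[OF k T] by (auto simp: l_def)
    show ?thesis
    proof (cases "\<mu> < 1 / sqrt t")
      case True
      \<comment> \<open>Any set of this size works: its expansion is at most the degree bound
        \<open>6 * k \<le> l\<close>. As the floor is at least 1, rounding down loses less than a
        factor 2.\<close>
      have "nat \<lfloor>\<mu> * t\<rfloor> \<le> card VH" using mut2 mut H(2) by linarith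
      then obtain S where S: "S \<subseteq> VH" "card S = nat \<lfloor>\<mu> * t\<rfloor>"
        by (meson obtain_subset_with_card_n)
      have "1 \<le> \<lfloor>\<mu> * t\<rfloor>" using mut by simp
      then have cSf: "real (card S) = of_int \<lfloor>\<mu> * t\<rfloor>" and f1: "1 \<le> real_of_int \<lfloor>\<mu> * t\<rfloor>"
        using S(2) by simp_all
      have cS: "\<mu> * t / 3 \<le> card S" "card S \<le> \<mu> * t" "1 \<le> real (card S)"
        using cSf f1 real_of_int_floor_add_one_gt[of "\<mu> * t"] of_int_floor_le[of "\<mu> * t"] by linarith+
      have "card (edge_boundary EH S) \<le> 6 * k * card S"
        using deg S(1) finVH finEH finite_subset by (intro card_edge_boundary_le_degree) auto
      then have "card (neighborhood VH EH S) \<le> 6 * k * card S"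
        using card_neighborhood_le_edge_boundary[OF finEH, of VH S] by linarith
      then have "vertex_expansion VH EH S \<le> 6 * k"
        using cS by (simp add: vertex_expansion_def field_simps)
      also have "\<dots> \<le> 1/2 * (14 * l)^2"
      proof -
        have "1 * l \<le> l * l" using l1000 by (intro mult_right_mono) auto
        then have "6 * k \<le> 98 * (l * l)" using kl l1000 by linarith
        then show ?thesis by (simp add: power2_eq_square)
      qed
      also have "\<dots> \<le> log 2 (1 / \<mu>) / log 2 (real t) * (14 * l)^2"
        using half[OF True] by (intro mult_right_mono) auto
      finally show ?thesis using S cS by (intro goal[of S]) auto
    next
      case False
      \<comment> \<open>The factor 2 comes from \<open>log (card C) \<ge> log t / 2\<close>, valid
        since all sets that are cut have at least \<open>sqrt t\<close> vertices.\<close>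
      define \<phi> where "\<phi> = 2 * l^2 / log 2 t"
      have phi0: "\<phi> \<ge> 0" using lt by (simp add: \<phi>_def)
      have cut: "\<exists>A B. A \<union> B = C \<and> A \<inter> B = {} \<and> card A \<le> 2/3 * real (card C) \<and>
        card B \<le> 2/3 * real (card C) \<and> card (edges_between EH A B) \<le> \<phi> * card C"
        if C: "C \<subseteq> VH" "\<mu> * t < card C" for C
      proof -
        have C2: "2 \<le> card C" using C(2) mut by linarith
        have sC: "sqrt t \<le> card C" using sqt[OF False] C(2) by linarith
        have Ct: "card C \<le> t" using C(1) finVH H(2) card_mono by blast
        show ?thesis
        proof (cases "card C < T")
          case True
          \<comment> \<open>The cut of a forest costs at most one vertex degree, far below
            \<open>\<phi> * sqrt t \<ge> l^2 / 2\<close>.\<close>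
          have "6 * k \<le> \<phi> * card C"
          proof -
            have "6 * k \<le> l" by (fact kl)
            also have "\<dots> \<le> 2 * l^2 / 4" using l1000 by (simp add: power2_eq_square)
            also have "\<dots> = 2 * l^2 / (4 * sqrt t) * sqrt t" using t3 by simp
            also have "\<dots> \<le> \<phi> * card C" unfolding \<phi>_def
              using lsq lt sC t3 by (intro mult_mono divide_left_mono) auto
            finally show ?thesis .
          qed
          then show ?thesis
            using balanced_cut_of_forest[OF H'(1) C(1) C2 small_forest[OF C(1) True] deg] k(1)
            by (fastforce intro: order_trans)
        next
          case False
          define s where "s = real (card C)"
          have T': "log 2 (real n) / (6 * k)^2 \<le> s" using False by (simp add: T_def s_def)
          have s: "3 \<le> s" "1000 \<le> log 2 (log 2 s)"
            using loglog_ge_of_girth_bound[OF k T'] by auto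
          have s1: "log 2 t / 2 \<le> log 2 s"
          proof -
            have "log 2 (sqrt t) \<le> log 2 s"
              using sC t3 s by (subst log_le_cancel_iff) (auto simp: s_def)
            moreover have "log 2 (sqrt t) = log 2 t / 2" using t3 by (simp add: log_def ln_sqrt)
            ultimately show ?thesis by simp
          qed
          have "log 2 s \<le> log 2 t"
            using Ct s t3 by (subst log_le_cancel_iff) (auto simp: s_def)
          moreover have "0 < log 2 s" using s1 lt by linarith
          ultimately have s2: "log 2 (log 2 s) \<le> l"
            unfolding l_def using lt by (subst log_le_cancel_iff) auto
          have "real (sep_E C (induced_edges EH C)) \<le> s / log 2 s * (log 2 (log 2 s))^2"
            using sep[OF induced_subgraph[OF H(1) C(1)] refl] T' by (auto simp: s_def)
          also have "\<dots> \<le> s / (log 2 t / 2) * l^2"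
            using s s1 s2 lt by (intro mult_mono divide_left_mono power_mono) auto
          also have "\<dots> = \<phi> * card C" by (simp add: \<phi>_def s_def)
          finally have le: "sep_E C (induced_edges EH C) \<le> \<phi> * card C" .
          obtain A B where AB: "A \<union> B = C" "A \<inter> B = {}" "card A \<le> 2/3 * real (card C)"
            "card B \<le> 2/3 * real (card C)"
            "card (edges_between EH A B) \<le> sep_E C (induced_edges EH C)"
            using balanced_cut_of_sep_E[OF H'(1) C(1) C2] by blast
          moreover have "card (edges_between EH A B) \<le> \<phi> * card C"
            using le AB(5) by linarith
          ultimately show ?thesis by blast
        qed
      qed
      have mut0: "0 < \<mu> * t" using mut by linarith
      \<comment> \<open>The recursion starts from \<open>VH\<close> with ratio 0.\<close>
      have "edge_boundary EH VH = {}" using H'(1) by (auto simp: edge_boundary_def simple_graph_def)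
      then obtain S where S: "S \<subseteq> VH" "\<mu> * t / 3 \<le> card S" "card S \<le> \<mu> * t"
        "card (edge_boundary EH S) / card S \<le> 2 * \<phi> * (log (3/2) (t / (\<mu> * t)) + 1)"
        using small_edge_boundary_of_balanced_cuts[OF H'(1) mut0 phi0 cut subset_refl] mut2 H(2)
        by auto
      have q: "real t / (\<mu> * t) = 1 / \<mu>" using t3 by simp
      have "vertex_expansion VH EH S \<le> card (edge_boundary EH S) / card S"
        unfolding vertex_expansion_def
        using card_neighborhood_le_edge_boundary[OF finEH, of VH S] by (intro divide_right_mono) auto
      also have "\<dots> \<le> 2 * \<phi> * (log (3/2) (1 / \<mu>) + 1)" using S(4) unfolding q .
      \<comment> \<open>Changing the base costs a factor of at most 2, and
        \<open>1 \<le> 2 * log 2 (1 / \<mu>)\<close> absorbs the summand 1. The total constant is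
        \<open>2 * 2 * 4 = 16\<close>, below \<open>14^2\<close>.\<close>
      also have "\<dots> \<le> 2 * \<phi> * (4 * log 2 (1 / \<mu>))"
      proof -
        have "log (3/2) (1 / \<mu>) = log 2 (1 / \<mu>) / log 2 (3/2)"
          using log_base_change[of 2 "3/2" "1 / \<mu>"] by simp
        also have "\<dots> \<le> log 2 (1 / \<mu>) / (1/2)"
          using lmu log2_three_halves_ge by (intro divide_left_mono) auto
        finally show ?thesis using lmu phi0 by (intro mult_left_mono) auto
      qed
      also have "\<dots> = log 2 (1 / \<mu>) / log 2 t * (16 * l^2)" by (simp add: \<phi>_def)
      also have "\<dots> \<le> log 2 (1 / \<mu>) / log 2 t * (14 * l)^2"
        using ratio0 by (intro mult_left_mono) (auto simp: power_mult_distrib)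
      finally show ?thesis using S by (intro goal[of S]) auto
    qed
  qed
qed

end
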